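(* Let $X$ be a Banach space and let $u:(0,\infty)\to(0,\infty)$ be a function such that for any $\varepsilon>0$ and any $x,y\in X$ with $\|x\|\leq\|y\|\leq 1$ and $\|x-y\|\geq\varepsilon$ we have $$\left\|\frac{x+y}{2}\right\|\leq\|y\|-u(\varepsilon).$$ Let $d\geq 1$ and let $T_1,\ldots,T_d:X\to X$ be commuting linear operators such that for all $l\in\{1,\ldots,d\}$ and all $x\in X$, $\|T_l x\|\leq\|x\|$. For any $x\in X$ and $k=(k_1,\ldots,k_d)\in\mathbb{N}^d$, denote $T^k x:=T_1^{k_1}\cdots T_d^{k_d}x$. Let $x\in X$ with $\|x\|\leq 1$ and put, for all $n\in\mathbb{N}$, $$x_n:=\frac{1}{(n+1)^d}\sum_{k\in[0,n]^d}T^k x.$$ Let $\varepsilon>0$ and $g:\mathbb{N}\to\mathbb{N}$. Then there is an $N\in\mathbb{N}$ with $N\leq\Theta_{u,d}(\varepsilon,g)$ such that for all $i,j\in[N,N+g(N)]$, $\|x_i-x_j\|\leq\varepsilon$, where $\Theta_{u,d}(\varepsilon,g)$ is the explicit natural number defined in the context.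
   Context: $\mathbb{N}$ includes $0$, and the intervals $[0,n]$ and $[N,N+g(N)]$ denote intervals of natural numbers. For $f:\mathbb{N}\to\mathbb{N}$, define $\widetilde{f}:\mathbb{N}\to\mathbb{N}$ by $\widetilde{f}(n):=n+f(n)$, define $f^M:\mathbb{N}\to\mathbb{N}$ by $f^M(n):=\max_{i\leq n}f(i)$, and for $n\in\mathbb{N}$ let $f^{(n)}$ denote the $n$-fold composition of $f$ with itself. Let $f:\mathbb{N}\to\mathbb{N}$ be the specific function $f(s):=2s^2+2s$. For $\varepsilon>0$ and $g:\mathbb{N}\to\mathbb{N}$ put $$G(\varepsilon,g):=\left((f\circ g)^M\right)^{\left(\left\lceil\frac{1}{\varepsilon}\right\rceil\right)}(0).$$ For $d\in\mathbb{N}$ with $d\geq 1$, reals $\delta,\gamma,\varepsilon>0$, $Q,n\in\mathbb{N}$, $g:\mathbb{N}\to\mathbb{N}$ and $u:(0,\infty)\to(0,\infty)$, define \begin{align*} \Phi(d,\delta,Q)&:=\max\left(Q,\left\lceil\frac{2^dQ}{\delta}\right\rceil\right),\\ h_{\gamma,g,d}(n)&:=\widetilde{g}\left(\Phi\left(d,\frac{\gamma}{2},n\right)\right),\\ \Psi(d,\gamma,g)&:=\Phi\left(d,\frac{\gamma}{2},G\left(\frac{\gamma}{2},h_{\gamma,g,d}\right)\right),\\ \Theta_{u,d}(\varepsilon,g)&:=\Psi\left(d,\frac{u(\varepsilon)}{2},g\right). \end{align*} *)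

theory Defs
  imports "HOL-Analysis.Analysis"
begin

definition tilde :: "(nat \<Rightarrow> nat) \<Rightarrow> nat \<Rightarrow> nat" where
  "tilde f n = n + f n"

definition maj :: "(nat \<Rightarrow> nat) \<Rightarrow> nat \<Rightarrow> nat" where
  "maj f n = Max (f ` {..n})"

text \<open>The bound is built from \<open>f s = 2 * s\<^sup>2 + 2 * s\<close>, the largest code of a pair
  in \<open>{0..s} \<times> {0..s}\<close> under the Cantor pairing function.\<close>

definition pair_bound :: "nat \<Rightarrow> nat" where
  "pair_bound s = 2 * s ^ 2 + 2 * s"

definition G :: "real \<Rightarrow> (nat \<Rightarrow> nat) \<Rightarrow> nat" where
  "G \<epsilon> g = (maj (pair_bound \<circ> g) ^^ nat \<lceil>1 / \<epsilon>\<rceil>) 0"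

definition Phi :: "nat \<Rightarrow> real \<Rightarrow> nat \<Rightarrow> nat" where
  "Phi d \<delta> Q = max Q (nat \<lceil>2 ^ d * real Q / \<delta>\<rceil>)"

definition h :: "real \<Rightarrow> (nat \<Rightarrow> nat) \<Rightarrow> nat \<Rightarrow> nat \<Rightarrow> nat" where
  "h \<gamma> g d n = tilde g (Phi d (\<gamma> / 2) n)"

definition Psi :: "nat \<Rightarrow> real \<Rightarrow> (nat \<Rightarrow> nat) \<Rightarrow> nat" where
  "Psi d \<gamma> g = Phi d (\<gamma> / 2) (G (\<gamma> / 2) (h \<gamma> g d))"

definition Theta :: "(real \<Rightarrow> real) \<Rightarrow> nat \<Rightarrow> real \<Rightarrow> (nat \<Rightarrow> nat) \<Rightarrow> nat" where
  "Theta u d \<epsilon> g = Psi d (u \<epsilon> / 2) g"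

text \<open>The operators are \<open>T 1, \<dots>, T d\<close>; the values of \<open>T\<close> and of a multi-index \<open>k\<close>
  outside \<open>{1..d}\<close> are irrelevant. The extensional function space in \<open>ergodic_avg\<close>
  makes each multi-index in \<open>{0..n}\<^sup>d\<close> occur exactly once in the sum.\<close>

definition multi_pow ::
  "nat \<Rightarrow> (nat \<Rightarrow> 'a \<Rightarrow> 'a) \<Rightarrow> (nat \<Rightarrow> nat) \<Rightarrow> 'a \<Rightarrow> 'a" where
  "multi_pow d T k x = foldr (\<lambda>l. T l ^^ k l) [1..<Suc d] x"

definition ergodic_avg ::
  "nat \<Rightarrow> (nat \<Rightarrow> 'a \<Rightarrow> 'a) \<Rightarrow> 'a::real_vector \<Rightarrow> nat \<Rightarrow> 'a" where
  "ergodic_avg d T x n =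
     (1 / (real n + 1) ^ d) *\<^sub>R (\<Sum>k \<in> {1..d} \<rightarrow>\<^sub>E {0..n}. multi_pow d T k x)"

end

theory Submission
  imports Defs
begin

text \<open>Let \<open>A\<^sub>n\<close> be the operator \<open>x \<mapsto> x\<^sub>n\<close>. It is a composition of one-parameter Cesaro means, so
  \<open>A\<^sub>n A\<^sub>q\<close> differs from \<open>A\<^sub>n\<close> by at most \<open>2 d q / (n + 1)\<close> in norm. Choose a pair \<open>p, q \<le> Q\<close> whose
  value \<open>a = \<parallel>(x\<^sub>p + x\<^sub>q) / 2\<parallel>\<close> is, up to \<open>\<gamma> / 2\<close>, minimal among all pairs bounded by \<open>h Q\<close>. Since
  \<open>a \<in> [0, 1]\<close>, such a \<open>Q\<close> occurs after at most \<open>\<lceil>2 / \<gamma>\<rceil>\<close> improvements. Once \<open>i, j\<close> are large compared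
  with \<open>Q\<close>, both \<open>\<parallel>x\<^sub>i\<parallel>\<close> and \<open>\<parallel>x\<^sub>j\<parallel>\<close> are at most \<open>a + \<gamma> / 2\<close>, whereas \<open>\<parallel>(x\<^sub>i + x\<^sub>j) / 2\<parallel> \<ge> a - \<gamma> / 2\<close>;
  as \<open>\<gamma> = u \<epsilon> / 2\<close>, uniform convexity forces \<open>\<parallel>x\<^sub>i - x\<^sub>j\<parallel> \<le> \<epsilon>\<close>.\<close>

section \<open>Linear contractions and the Cesaro means of a single operator\<close>

definition lin_contraction :: "('a::real_normed_vector \<Rightarrow> 'a) \<Rightarrow> bool" where
  "lin_contraction S \<longleftrightarrow> linear S \<and> (\<forall>y. norm (S y) \<le> norm y)"

definition cesaro :: "('a::real_normed_vector \<Rightarrow> 'a) \<Rightarrow> nat \<Rightarrow> 'a \<Rightarrow> 'a" where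
  "cesaro S n y = (1 / (real n + 1)) *\<^sub>R (\<Sum>k\<in>{0..n}. (S ^^ k) y)"

lemma lin_contraction_id: "lin_contraction (\<lambda>y. y)"
  by (simp add: lin_contraction_def linear_iff)

lemma lin_contraction_comp:
  "lin_contraction R \<Longrightarrow> lin_contraction S \<Longrightarrow> lin_contraction (\<lambda>y. R (S y))"
  unfolding lin_contraction_def using linear_compose[of S R]
  by (auto simp: o_def intro: order_trans)

lemma lin_contraction_funpow: "lin_contraction S \<Longrightarrow> lin_contraction (S ^^ k)"
proof (induction k)
  case 0
  show ?case by (simp add: lin_contraction_def linear_iff)
next
  case (Suc k)
  then show ?case using lin_contraction_comp[of S "S ^^ k"] by (simp add: o_def)
qed

lemma lin_contraction_cesaro:
  assumes "lin_contraction S"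
  shows "lin_contraction (cesaro S n)"
  unfolding lin_contraction_def
proof (intro conjI allI)
  have l: "linear (S ^^ k)" for k
    using lin_contraction_funpow[OF assms] by (simp add: lin_contraction_def)
  show "linear (cesaro S n)"
    by (rule linearI)
      (simp_all add: cesaro_def linear_add[OF l] linear_cmul[OF l] sum.distrib scaleR_add_right
        scaleR_sum_right[symmetric])
  fix y
  have "norm (\<Sum>k\<in>{0..n}. (S ^^ k) y) \<le> (\<Sum>k\<in>{0..n}. norm y)"
    by (rule sum_norm_le) (use lin_contraction_funpow[OF assms] in \<open>auto simp: lin_contraction_def\<close>)
  then show "norm (cesaro S n y) \<le> norm y"
    by (simp add: cesaro_def divide_simps mult.commute add.commute)
qed

lemma cesaro_commute:
  assumes "linear R" and "\<And>y. R (S y) = S (R y)"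
  shows "R (cesaro S n y) = cesaro S n (R y)"
proof -
  have "R ((S ^^ k) z) = (S ^^ k) (R z)" for k z
    by (induction k) (simp_all add: assms(2))
  then show ?thesis
    by (simp add: cesaro_def linear_cmul[OF assms(1)] linear_sum[OF assms(1)])
qed

text \<open>A single shift makes the sum telescope to \<open>(S ^^ Suc n) z - z\<close>, of norm at
  most \<open>2 * norm y\<close>. The errors of \<open>k\<close> successive shifts add up by the
  triangle inequality.\<close>

lemma cesaro_shift:
  assumes "lin_contraction S"
  shows "norm (cesaro S n ((S ^^ k) y) - cesaro S n y) \<le> 2 * real k / (real n + 1) * norm y"
proof (induction k)
  case 0
  show ?case by simp
next
  case (Suc k)
  define z where "z = (S ^^ k) y"
  have contr: "norm ((S ^^ m) w) \<le> norm w" for m w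
    using lin_contraction_funpow[OF assms] by (simp add: lin_contraction_def)
  have "cesaro S n (S z) - cesaro S n z
      = (1 / (real n + 1)) *\<^sub>R (\<Sum>i\<in>{0..n}. (S ^^ Suc i) z - (S ^^ i) z)"
    by (simp add: cesaro_def sum_subtractf scaleR_diff_right funpow_swap1)
  also have "(\<Sum>i\<in>{0..n}. (S ^^ Suc i) z - (S ^^ i) z) = (S ^^ Suc n) z - z"
    using sum_Suc_diff[of 0 "n" "\<lambda>i. (S ^^ i) z"] by simp
  finally have "norm (cesaro S n (S z) - cesaro S n z) = norm ((S ^^ Suc n) z - z) / (real n + 1)"
    by simp
  also have "norm ((S ^^ Suc n) z - z) \<le> 2 * norm y"
    using norm_triangle_ineq4[of "(S ^^ Suc n) z" z] contr[of "Suc n" z] contr[of k y]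
    unfolding z_def by linarith
  finally have step: "norm (cesaro S n (S z) - cesaro S n z) \<le> 2 * norm y / (real n + 1)"
    by (simp add: divide_right_mono)
  have "norm (cesaro S n (S z) - cesaro S n y)
      \<le> 2 * norm y / (real n + 1) + 2 * real k / (real n + 1) * norm y"
    using norm_triangle_le[OF add_mono[OF step Suc.IH[folded z_def]]] by simp
  also have "\<dots> = 2 * real (Suc k) / (real n + 1) * norm y"
    by (simp add: algebra_simps add_divide_distrib)
  finally show ?case by (simp add: z_def)
qed

text \<open>Since \<open>cesaro S m y\<close> is the mean of the shifts \<open>(S ^^ k) y\<close>
  with \<open>k \<le> m\<close>, the difference is a mean of the differences estimated in
  \<open>cesaro_shift\<close>.\<close>

lemma cesaro_absorb:
  assumes "lin_contraction S"
  shows "norm (cesaro S n (cesaro S m y) - cesaro S n y) \<le> 2 * real m / (real n + 1) * norm y"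
proof -
  have l: "linear (cesaro S n)"
    using lin_contraction_cesaro[OF assms] by (simp add: lin_contraction_def)
  let ?c = "2 * real m / (real n + 1) * norm y"
  have "cesaro S n y = (1 / (real m + 1)) *\<^sub>R (\<Sum>k\<in>{0..m}. cesaro S n y)"
    by (simp add: sum_constant_scaleR add.commute)
  then have eq: "cesaro S n (cesaro S m y) - cesaro S n y
      = (1 / (real m + 1)) *\<^sub>R (\<Sum>k\<in>{0..m}. cesaro S n ((S ^^ k) y) - cesaro S n y)"
    unfolding sum_subtractf cesaro_def[of S m]
    by (metis linear_cmul[OF l] linear_sum[OF l] scaleR_diff_right)
  have le: "norm (\<Sum>k\<in>{0..m}. cesaro S n ((S ^^ k) y) - cesaro S n y) \<le> (\<Sum>k\<in>{0..m}. ?c)"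
  proof (rule sum_norm_le)
    fix k assume "k \<in> {0..m}"
    then have "2 * real k / (real n + 1) * norm y \<le> ?c"
      by (intro mult_right_mono divide_right_mono) auto
    with cesaro_shift[OF assms] show "norm (cesaro S n ((S ^^ k) y) - cesaro S n y) \<le> ?c"
      by (rule order_trans)
  qed
  have "norm (cesaro S n (cesaro S m y) - cesaro S n y) \<le> (\<Sum>k\<in>{0..m}. ?c) / (real m + 1)"
    unfolding eq using divide_right_mono[OF le, of "real m + 1"] by simp
  moreover have "(\<Sum>k\<in>{0..m}. c) / (real m + 1) = c" for c :: real
    by (simp add: add.commute)
  ultimately show ?thesis by (simp only:)
qed

section \<open>Multi-parameter averages as compositions of Cesaro means\<close>

lemma multi_pow_Suc: "multi_pow (Suc d) T k y = multi_pow d T k ((T (Suc d) ^^ k (Suc d)) y)"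
  by (simp add: multi_pow_def)

lemma multi_pow_upd: "multi_pow d T (k(Suc d := j)) y = multi_pow d T k y"
  unfolding multi_pow_def by (rule foldr_cong) auto

lemma linear_multi_pow:
  "(\<And>l. l \<in> {1..d} \<Longrightarrow> lin_contraction (T l)) \<Longrightarrow> linear (multi_pow d T k)"
proof (induction d)
  case 0
  show ?case by (simp add: multi_pow_def[abs_def] linear_iff)
next
  case (Suc d)
  have "linear (T (Suc d) ^^ k (Suc d))"
    using lin_contraction_funpow[OF Suc.prems] by (simp add: lin_contraction_def)
  moreover have "linear (multi_pow d T k)" using Suc by simp
  ultimately show ?case
    using linear_compose by (fastforce simp: multi_pow_Suc[abs_def] o_def)
qed

lemma ergodic_avg_0: "ergodic_avg 0 T y n = y"
  by (simp add: ergodic_avg_def multi_pow_def)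

text \<open>Splitting off the last coordinate of a multi-index gives a double sum, and linearity of
  \<open>multi_pow d T k\<close> moves the sum over that coordinate inside. This opens the way to
  induction on \<open>d\<close>.\<close>

lemma ergodic_avg_Suc:
  assumes "\<And>l. l \<in> {1..Suc d} \<Longrightarrow> lin_contraction (T l)"
  shows "ergodic_avg (Suc d) T y n = ergodic_avg d T (cesaro (T (Suc d)) n y) n"
proof -
  let ?P = "{1..d} \<rightarrow>\<^sub>E {0..n}" and ?S = "T (Suc d)"
  have l: "linear (multi_pow d T k)" for k
    by (rule linear_multi_pow) (use assms in auto)
  have inj: "inj_on (\<lambda>(j, k). k(Suc d := j)) ({0..n} \<times> ?P)"
    by (rule inj_combinator) simp
  have "{1..Suc d} \<rightarrow>\<^sub>E {0..n} = (\<lambda>(j, k). k(Suc d := j)) ` ({0..n} \<times> ?P)"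
    using PiE_insert_eq[of "Suc d" "{1..d}" "\<lambda>_. {0..n}"] by (simp add: atLeastAtMostSuc_conv)
  then have "(\<Sum>k\<in>{1..Suc d} \<rightarrow>\<^sub>E {0..n}. multi_pow (Suc d) T k y)
      = (\<Sum>x\<in>{0..n} \<times> ?P. multi_pow (Suc d) T ((\<lambda>(j, k). k(Suc d := j)) x) y)"
    by (simp only: sum.reindex[OF inj] o_def)
  also have "\<dots> = (\<Sum>(j, k)\<in>{0..n} \<times> ?P. multi_pow d T k ((?S ^^ j) y))"
    by (rule sum.cong) (auto simp: multi_pow_Suc multi_pow_upd)
  also have "\<dots> = (\<Sum>k\<in>?P. \<Sum>j\<in>{0..n}. multi_pow d T k ((?S ^^ j) y))"
    by (subst sum.cartesian_product[symmetric]) (rule sum.swap)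
  also have "\<dots> = (\<Sum>k\<in>?P. multi_pow d T k (\<Sum>j\<in>{0..n}. (?S ^^ j) y))"
    by (simp add: linear_sum[OF l])
  finally show ?thesis
    by (simp add: ergodic_avg_def cesaro_def linear_cmul[OF l] scaleR_sum_right[symmetric] mult.commute)
qed

lemma lin_contraction_ergodic_avg:
  "(\<And>l. l \<in> {1..d} \<Longrightarrow> lin_contraction (T l)) \<Longrightarrow> lin_contraction (\<lambda>y. ergodic_avg d T y n)"
proof (induction d)
  case 0
  show ?case by (simp add: ergodic_avg_0 lin_contraction_id)
next
  case (Suc d)
  have "lin_contraction (\<lambda>y. ergodic_avg d T (cesaro (T (Suc d)) n y) n)"
    by (rule lin_contraction_comp[OF Suc.IH lin_contraction_cesaro]) (use Suc.prems in auto)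
  moreover have "ergodic_avg (Suc d) T y n = ergodic_avg d T (cesaro (T (Suc d)) n y) n" for y
    by (rule ergodic_avg_Suc) (use Suc.prems in auto)
  ultimately show ?case by simp
qed

text \<open>Serves, with \<open>R\<close> a Cesaro mean of the last operator, to regroup the product
  of two averages in \<open>ergodic_avg_absorb\<close>.\<close>

lemma ergodic_avg_commute:
  assumes "linear R" and "\<And>l. l \<in> {1..d} \<Longrightarrow> lin_contraction (T l)"
    and "\<And>l y. l \<in> {1..d} \<Longrightarrow> R (T l y) = T l (R y)"
  shows "R (ergodic_avg d T y n) = ergodic_avg d T (R y) n"
  using assms
proof (induction d arbitrary: y)
  case 0
  show ?case by (simp add: ergodic_avg_0)
next
  case (Suc d)
  have avg: "ergodic_avg (Suc d) T y k = ergodic_avg d T (cesaro (T (Suc d)) k y) k" for y k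
    by (rule ergodic_avg_Suc) (use Suc.prems in auto)
  have "R (ergodic_avg (Suc d) T y n) = ergodic_avg d T (R (cesaro (T (Suc d)) n y)) n"
    unfolding avg by (rule Suc.IH) (use Suc.prems in auto)
  also have "R (cesaro (T (Suc d)) n y) = cesaro (T (Suc d)) n (R y)"
    by (rule cesaro_commute[OF Suc.prems(1)]) (simp add: Suc.prems(3))
  finally show ?case by (simp add: avg)
qed

text \<open>Each operator contributes one error term from \<open>cesaro_absorb\<close>; the
  remaining averages are contractions and do not enlarge it.\<close>

lemma ergodic_avg_absorb:
  assumes "\<And>l. l \<in> {1..d} \<Longrightarrow> lin_contraction (T l)"
    and "\<And>l m y. l \<in> {1..d} \<Longrightarrow> m \<in> {1..d} \<Longrightarrow> T l (T m y) = T m (T l y)"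
  shows "norm (ergodic_avg d T (ergodic_avg d T y m) n - ergodic_avg d T y n)
    \<le> 2 * real d * real m / (real n + 1) * norm y"
  using assms
proof (induction d arbitrary: y)
  case 0
  show ?case by (simp add: ergodic_avg_0)
next
  case (Suc d)
  let ?A = "\<lambda>n y. ergodic_avg d T y n" and ?C = "cesaro (T (Suc d))"
  let ?c = "2 * real m / (real n + 1) * norm y"
  have avg: "ergodic_avg (Suc d) T y k = ergodic_avg d T (cesaro (T (Suc d)) k y) k" for y k
    by (rule ergodic_avg_Suc) (use Suc.prems in auto)
  have S: "lin_contraction (T (Suc d))" using Suc.prems(1) by simp
  have C: "linear (?C k)" "norm (?C k z) \<le> norm z" for k z
    using lin_contraction_cesaro[OF S] by (auto simp: lin_contraction_def)
  have A: "linear (?A k)" "norm (?A k z) \<le> norm z" for k z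
    using lin_contraction_ergodic_avg[of d T] Suc.prems(1) by (auto simp: lin_contraction_def)
  have TC: "?C n (T l z) = T l (?C n z)" if "l \<in> {1..d}" for l z
    by (rule cesaro_commute[symmetric])
      (use that Suc.prems in \<open>auto simp: lin_contraction_def\<close>)
  have "?C n (?A m z) = ?A m (?C n z)" for z
    by (rule ergodic_avg_commute[OF C(1)]) (use Suc.prems(1) TC in auto)
  \<comment> \<open>After \<open>?C n\<close> is moved past \<open>?A m\<close>, the term
    \<open>?A n (?A m (?C n y))\<close> is inserted. The first summand is the error of the last
    operator, the second is covered by the induction hypothesis at \<open>?C n y\<close>.\<close>
  then have "ergodic_avg (Suc d) T (ergodic_avg (Suc d) T y m) n - ergodic_avg (Suc d) T y n
      = ?A n (?A m (?C n (?C m y) - ?C n y)) + (?A n (?A m (?C n y)) - ?A n (?C n y))"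
    by (simp add: avg linear_diff[OF A(1)])
  moreover have "norm (?A n (?A m (?C n (?C m y) - ?C n y))) \<le> ?c"
    using A(2) cesaro_absorb[OF S] order_trans by meson
  moreover have "norm (?A n (?A m (?C n y)) - ?A n (?C n y)) \<le> 2 * real d * real m / (real n + 1) * norm y"
  proof -
    have "norm (?A n (?A m (?C n y)) - ?A n (?C n y)) \<le> 2 * real d * real m / (real n + 1) * norm (?C n y)"
      by (rule Suc.IH) (use Suc.prems in auto)
    also have "\<dots> \<le> 2 * real d * real m / (real n + 1) * norm y"
      by (rule mult_left_mono) (simp_all add: C(2))
    finally show ?thesis .
  qed
  ultimately have "norm (ergodic_avg (Suc d) T (ergodic_avg (Suc d) T y m) n - ergodic_avg (Suc d) T y n)
      \<le> ?c + 2 * real d * real m / (real n + 1) * norm y"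
    by (simp only:) (rule norm_triangle_le, rule add_mono)
  also have "\<dots> = 2 * real (Suc d) * real m / (real n + 1) * norm y"
    by (simp add: algebra_simps add_divide_distrib)
  finally show ?case .
qed

section \<open>The threshold \<open>Phi\<close> and the search for a nearly minimal pair\<close>

lemma Phi_mono:
  assumes "P \<le> Q" and "\<delta> > 0"
  shows "Phi d \<delta> P \<le> Phi d \<delta> Q"
  unfolding Phi_def using assms
  by (intro max.mono nat_mono ceiling_mono divide_right_mono mult_left_mono) auto

lemma maj_ge: "m \<le> n \<Longrightarrow> f m \<le> maj f n"
  by (simp add: maj_def)

lemma mono_maj: "mono (maj f)"
  unfolding maj_def by (rule monoI, rule Max_mono) auto

lemma two_mult_le_power: "2 * n \<le> (2::nat) ^ n"
proof (cases n)
  case (Suc m)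
  then show ?thesis using less_exp[of m] Suc_leI[of m "2 ^ m"] by simp
qed simp

text \<open>The factor \<open>2 ^ d\<close> in \<open>Phi\<close> dominates the \<open>2 * d\<close>
  of the absorption estimate, so the error falls below \<open>\<delta>\<close> from
  \<open>Phi d \<delta> Q\<close> on.\<close>

lemma ergodic_avg_absorb_Phi:
  assumes "\<And>l. l \<in> {1..d} \<Longrightarrow> lin_contraction (T l)"
    and "\<And>l m y. l \<in> {1..d} \<Longrightarrow> m \<in> {1..d} \<Longrightarrow> T l (T m y) = T m (T l y)"
    and "norm y \<le> 1" and "m \<le> Q" and "\<delta> > 0" and "Phi d \<delta> Q \<le> n"
  shows "norm (ergodic_avg d T (ergodic_avg d T y m) n - ergodic_avg d T y n) \<le> \<delta>"
proof -
  have "2 ^ d * real Q / \<delta> \<le> real n"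
    using assms(6) unfolding Phi_def by linarith
  then have "2 ^ d * real Q \<le> \<delta> * (real n + 1)"
    using assms(5) by (simp add: field_simps)
  moreover have "2 * real d * real m \<le> 2 ^ d * real Q"
    using of_nat_mono[OF mult_le_mono[OF two_mult_le_power[of d] assms(4)], where 'a = real] by simp
  ultimately have "2 * real d * real m / (real n + 1) \<le> \<delta>"
    by (simp add: divide_simps)
  moreover have "2 * real d * real m / (real n + 1) * norm y \<le> 2 * real d * real m / (real n + 1)"
    using assms(3) by (intro mult_left_le) simp_all
  ultimately show ?thesis
    using ergodic_avg_absorb[of d T y m n, OF assms(1,2)] by linarith
qed

text \<open>Although \<open>pair_bound\<close> is designed for coded pairs, \<open>Q\<close> need only dominate both members of
  the pair, for which \<open>s \<le> pair_bound s\<close> suffices.\<close>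

lemma approx_minimal_pair:
  fixes a :: "nat \<Rightarrow> nat \<Rightarrow> real"
  assumes "\<delta> > 0" and nonneg: "\<And>p q. 0 \<le> a p q" and "a 0 0 \<le> 1"
  obtains Q p q where "Q \<le> G \<delta> H" and "p \<le> Q" and "q \<le> Q"
    and "\<And>i j. i \<le> H Q \<Longrightarrow> j \<le> H Q \<Longrightarrow> a p q - \<delta> \<le> a i j"
proof -
  define F where "F = maj (pair_bound \<circ> H)"
  define K where "K = nat \<lceil>1 / \<delta>\<rceil>"
  \<comment> \<open>As \<open>F\<close> is monotone, its iterates at 0 increase, and
    \<open>G \<delta> H\<close> is the \<open>K\<close>-th one.\<close>
  have funpow_le: "(F ^^ k) 0 \<le> G \<delta> H" if "k \<le> K" for k
    unfolding G_def K_def[symmetric] F_def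
    using funpow_mono2[OF mono_maj that, of 0 0] by simp
  \<comment> \<open>The running maximum in \<open>F\<close> lets \<open>Q\<close> be smaller than
    the current iterate \<open>M\<close>.\<close>
  have le_F: "i \<le> F M" if "i \<le> H Q" "Q \<le> M" for i Q M
  proof -
    have "H Q \<le> pair_bound (H Q)" by (simp add: pair_bound_def)
    also have "\<dots> \<le> F M" using maj_ge[OF that(2), of "pair_bound \<circ> H"] by (simp add: F_def)
    finally show ?thesis using that(1) by simp
  qed
  have "\<exists>Q p q. Q \<le> G \<delta> H \<and> p \<le> Q \<and> q \<le> Q \<and> (\<forall>i \<le> H Q. \<forall>j \<le> H Q. a p q - \<delta> \<le> a i j)"
  proof (rule ccontr)
    assume contra: "\<not> ?thesis"
    \<comment> \<open>Each failure of near-minimality lowers the value by more than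
      \<open>\<delta>\<close>. Strictness for \<open>k > 0\<close> is recorded because
      \<open>1 - real K * \<delta>\<close> may be exactly 0, which nonnegativity alone would not
      contradict.\<close>
    have "\<exists>Q p q. Q \<le> (F ^^ k) 0 \<and> p \<le> Q \<and> q \<le> Q \<and>
        (k = 0 \<or> a p q < 1 - real k * \<delta>) \<and> a p q \<le> 1 - real k * \<delta>"
      if "k \<le> K" for k
      using that
    proof (induction k)
      case 0
      show ?case using assms(3) by (intro exI[of _ 0]) simp
    next
      case (Suc k)
      then have "k \<le> K" by simp
      from Suc.IH[OF this] obtain Q p q
        where Q: "Q \<le> (F ^^ k) 0" "p \<le> Q" "q \<le> Q" "a p q \<le> 1 - real k * \<delta>"
        by blast
      have "Q \<le> G \<delta> H" using Q(1) funpow_le[of k] Suc.prems by simp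
      then have "\<not> (\<forall>i \<le> H Q. \<forall>j \<le> H Q. a p q - \<delta> \<le> a i j)"
        using contra Q(2,3) by blast
      then obtain i j where ij: "i \<le> H Q" "j \<le> H Q" "a i j < a p q - \<delta>"
        by (auto simp: not_le)
      have le_max: "max i j \<le> (F ^^ Suc k) 0"
        using le_F[OF _ Q(1)] ij(1,2) by simp
      have less: "a i j < 1 - real (Suc k) * \<delta>"
        using ij(3) Q(4) by (simp add: algebra_simps)
      show ?case
        by (rule exI[of _ "max i j"], rule exI[of _ i], rule exI[of _ j])
          (use le_max less in simp)
    qed
    moreover have "1 / \<delta> \<le> real K" "K \<noteq> 0"
      using assms(1) unfolding K_def by (auto simp: not_le)
    ultimately obtain p q where "a p q < 1 - real K * \<delta>" by blast
    moreover have "1 \<le> real K * \<delta>"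
      using \<open>1 / \<delta> \<le> real K\<close> assms(1) by (simp add: field_simps)
    ultimately show False using nonneg[of p q] by linarith
  qed
  then show thesis using that by blast
qed

section \<open>Metastability of the averages from uniform convexity\<close>

theorem theorem2p4:
  fixes u :: "real \<Rightarrow> real"
    and d :: nat
    and T :: "nat \<Rightarrow> 'a::banach \<Rightarrow> 'a"
    and x :: 'a
    and \<epsilon> :: real
    and g :: "nat \<Rightarrow> nat"
  assumes u_pos: "\<And>e. e > 0 \<Longrightarrow> u e > 0"
    and u_convex: "\<And>e y z. e > 0 \<Longrightarrow> norm (y::'a) \<le> norm z \<Longrightarrow> norm z \<le> 1 \<Longrightarrow>
          norm (y - z) \<ge> e \<Longrightarrow> norm ((1 / 2) *\<^sub>R (y + z)) \<le> norm z - u e"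
    and d: "d \<ge> 1"
    and T_linear: "\<And>l. l \<in> {1..d} \<Longrightarrow> linear (T l)"
    and T_commute: "\<And>l m. l \<in> {1..d} \<Longrightarrow> m \<in> {1..d} \<Longrightarrow> T l \<circ> T m = T m \<circ> T l"
    and T_nonexp: "\<And>l y. l \<in> {1..d} \<Longrightarrow> norm (T l y) \<le> norm y"
    and x: "norm x \<le> 1"
    and eps: "\<epsilon> > 0"
  shows "\<exists>N. N \<le> Theta u d \<epsilon> g \<and>
           (\<forall>i\<in>{N..N + g N}. \<forall>j\<in>{N..N + g N}.
              norm (ergodic_avg d T x i - ergodic_avg d T x j) \<le> \<epsilon>)"
proof -
  define \<gamma> where "\<gamma> = u \<epsilon> / 2"
  have "\<gamma> > 0" using u_pos[OF eps] by (simp add: \<gamma>_def)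
  have contr: "\<And>l. l \<in> {1..d} \<Longrightarrow> lin_contraction (T l)"
    using T_linear T_nonexp by (simp add: lin_contraction_def)
  have comm: "\<And>l m y. l \<in> {1..d} \<Longrightarrow> m \<in> {1..d} \<Longrightarrow> T l (T m y) = T m (T l y)"
    using T_commute by (metis comp_apply)
  define A where "A n y = ergodic_avg d T y n" for n y
  have A: "linear (A n)" "norm (A n y) \<le> norm y" for n y
    using lin_contraction_ergodic_avg[of d T, OF contr] by (simp_all add: lin_contraction_def A_def[abs_def])
  let ?a = "\<lambda>p q. norm ((1 / 2) *\<^sub>R (A p x + A q x))"
  have "?a 0 0 \<le> 1"
    using A(2)[of 0 x] x by (simp flip: scaleR_2)
  then obtain Q p q where Q: "Q \<le> G (\<gamma> / 2) (h \<gamma> g d)" "p \<le> Q" "q \<le> Q"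
    and min: "\<And>i j. i \<le> h \<gamma> g d Q \<Longrightarrow> j \<le> h \<gamma> g d Q \<Longrightarrow> ?a p q - \<gamma> / 2 \<le> ?a i j"
    using approx_minimal_pair[of "\<gamma> / 2" ?a "h \<gamma> g d"] \<open>\<gamma> > 0\<close> by (metis half_gt_zero norm_ge_zero)
  \<comment> \<open>This \<open>N\<close> serves twice: averages from index \<open>N\<close> on
    absorb those up to \<open>Q\<close>, and \<open>N + g N\<close> is exactly
    \<open>h \<gamma> g d Q\<close>, the range in which the pair is nearly minimal.\<close>
  define N where "N = Phi d (\<gamma> / 2) Q"
  have "N \<le> Theta u d \<epsilon> g"
    unfolding N_def Theta_def Psi_def \<gamma>_def[symmetric]
    using Phi_mono[OF Q(1)] \<open>\<gamma> > 0\<close> by simp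
  moreover have upper: "norm (A i x) \<le> ?a p q + \<gamma> / 2" if "N \<le> i" for i
  proof -
    have close: "norm (A i (A m x) - A i x) \<le> \<gamma> / 2" if "m \<le> Q" for m
      unfolding A_def
      by (rule ergodic_avg_absorb_Phi[OF contr comm x that])
        (use \<open>\<gamma> > 0\<close> \<open>N \<le> i\<close> in \<open>auto simp: N_def\<close>)
    let ?w = "(1 / 2) *\<^sub>R (A p x + A q x)"
    \<comment> \<open>Both \<open>A p x\<close> and \<open>A q x\<close> are absorbed by
      \<open>A i\<close> up to \<open>\<gamma> / 2\<close>, hence so is their midpoint
      \<open>?w\<close>; contractivity then bounds \<open>A i ?w\<close> by
      \<open>norm ?w\<close>.\<close>
    have "A i ?w - A i x = (1 / 2) *\<^sub>R ((A i (A p x) - A i x) + (A i (A q x) - A i x))"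
      by (simp add: linear_cmul[OF A(1)] linear_add[OF A(1)] algebra_simps flip: scaleR_2)
    also have "norm \<dots> \<le> \<gamma> / 2"
      using norm_triangle_mono[OF close[OF Q(2)] close[OF Q(3)]] by simp
    finally show ?thesis
      using norm_triangle_ineq2[of "A i x" "A i ?w"] A(2)[of i ?w] by (simp add: norm_minus_commute)
  qed
  \<comment> \<open>The ordering of the norms is the one required by \<open>u_convex\<close>; the
    opposite case follows by symmetry.\<close>
  have near: "norm (A i x - A j x) \<le> \<epsilon>"
    if "i \<in> {N..N + g N}" "j \<in> {N..N + g N}" "norm (A i x) \<le> norm (A j x)" for i j
  proof (rule ccontr)
    assume "\<not> norm (A i x - A j x) \<le> \<epsilon>"
    then have "?a i j \<le> norm (A j x) - u \<epsilon>"
      using that(3) A(2)[of j x] x by (intro u_convex[OF eps]) auto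
    moreover have "?a p q - \<gamma> / 2 \<le> ?a i j"
      by (rule min) (use that in \<open>simp_all add: h_def tilde_def flip: N_def\<close>)
    moreover have "norm (A j x) \<le> ?a p q + \<gamma> / 2"
      using upper that(2) by simp
    \<comment> \<open>With \<open>u \<epsilon> = 2 * \<gamma>\<close> the three bounds give
      \<open>- \<gamma> / 2 \<le> \<gamma> / 2 - 2 * \<gamma>\<close>, that is,
      \<open>\<gamma> \<le> 0\<close>.\<close>
    ultimately show False
      using \<open>\<gamma> > 0\<close> unfolding \<gamma>_def by linarith
  qed
  have "norm (A i x - A j x) \<le> \<epsilon>" if "i \<in> {N..N + g N}" "j \<in> {N..N + g N}" for i j
    using near[OF that] near[OF that(2,1)] by (metis linear norm_minus_commute)
  ultimately show ?thesis unfolding A_def by blast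
qed

end
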